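(* Let $X$ be a $T_0$ topological space. Let $\mathcal H$ be the set of all $\mathcal D\subseteq\Gamma(X)$ such that (i) $\mathord{\downarrow}a\in\mathcal D$ for all $A\in\mathcal D$ and $a\in A$; (ii) $cl_d(\mathcal D)=\mathcal D$; (iii) $cl(\bigcup\mathcal D)=\bigcup\mathcal D$. Let $\mathcal K(\Gamma(X))$ be the set of all $A\in\Gamma(X)$ such that for every $\mathcal D\in\mathcal H$, $A\subseteq\sup\mathcal D$ implies $A\in\mathcal D$. Then $(\mathcal K(\Gamma(X)),\eta)$ is the $D$-completion of $X$, where $\eta(x)=\mathord{\downarrow}x$ for all $x\in X$.
   Context: $\Gamma(X)$ is the complete lattice of closed subsets of $X$ ordered by inclusion; suprema are taken in $\Gamma(X)$. The specialization order is $x\le y$ iff $x\in cl(\{y\})$, so $\mathord{\downarrow}x=cl(\{x\})$. A subset of a poset is $d$-closed if it contains the supremum (when it exists) of each of its directed subsets; $cl_d(B)$ is the smallest $d$-closed set containing $B$ (in (ii), within $(\Gamma(X),\subseteq)$). $\mathcal K(\Gamma(X))$ carries the relative topology of $\Gamma(X)$ with the lower Vietoris topology, generated by the sets $\diamondsuit U=\{A:A\cap U\neq\emptyset\}$, $U$ open in $X$. A monotone convergence space is a $T_0$ space in which the closure of every directed set (in the specialization order) is the closure of a unique point. A $D$-completion of a $T_0$ space $X$ is a monotone convergence space $Y$ with a topological embedding $j:X\to Y$ such that $cl_d(j(X))=Y$ (in the specialization order of $Y$). *)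

theory Defs
  imports "HOL-Analysis.Analysis" "HOL-Algebra.Complete_Lattice"
begin

text \<open>Posets are carrier-based records of type 'a gorder with equality as their equivalence.\<close>

definition directed_in :: "'a gorder \<Rightarrow> 'a set \<Rightarrow> bool" where
  "directed_in L D \<longleftrightarrow> D \<subseteq> carrier L \<and> D \<noteq> {} \<and>
     (\<forall>x\<in>D. \<forall>y\<in>D. \<exists>z\<in>D. x \<sqsubseteq>\<^bsub>L\<^esub> z \<and> y \<sqsubseteq>\<^bsub>L\<^esub> z)"

definition d_closed :: "'a gorder \<Rightarrow> 'a set \<Rightarrow> bool" where
  "d_closed L B \<longleftrightarrow> B \<subseteq> carrier L \<and>
     (\<forall>D s. D \<subseteq> B \<and> directed_in L D \<and> is_lub L s D \<longrightarrow> s \<in> B)"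

definition cl_d :: "'a gorder \<Rightarrow> 'a set \<Rightarrow> 'a set" where
  "cl_d L B = d_closed L hull B"

definition specialization :: "'a topology \<Rightarrow> 'a gorder" where
  "specialization X = \<lparr>carrier = topspace X, eq = (=), le = (\<lambda>x y. x \<in> X closure_of {y})\<rparr>"

definition closed_lattice :: "'a topology \<Rightarrow> 'a set gorder" where
  "closed_lattice X = \<lparr>carrier = {A. closedin X A}, eq = (=), le = (\<subseteq>)\<rparr>"

text \<open>The relativization in the next definition keeps the empty closed set, which meets no
  open set, in the underlying space.\<close>

definition lower_vietoris :: "'a topology \<Rightarrow> 'a set topology" where
  "lower_vietoris X = topology (arbitrary union_of (finite intersection_of
     (\<lambda>S. \<exists>U. openin X U \<and> S = {A. closedin X A \<and> A \<inter> U \<noteq> {}})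
     relative_to {A. closedin X A}))"

definition family_H :: "'a topology \<Rightarrow> 'a set set set" where
  "family_H X = {\<D>. \<D> \<subseteq> {A. closedin X A} \<and>
     (\<forall>A\<in>\<D>. \<forall>a\<in>A. X closure_of {a} \<in> \<D>) \<and>
     cl_d (closed_lattice X) \<D> = \<D> \<and>
     X closure_of (\<Union>\<D>) = \<Union>\<D>}"

definition K_sets :: "'a topology \<Rightarrow> 'a set set" where
  "K_sets X = {A. closedin X A \<and>
     (\<forall>\<D>\<in>family_H X. A \<subseteq> \<Squnion>\<^bsub>closed_lattice X\<^esub>\<D> \<longrightarrow> A \<in> \<D>)}"

definition K_space :: "'a topology \<Rightarrow> 'a set topology" where
  "K_space X = subtopology (lower_vietoris X) (K_sets X)"

definition monotone_convergence_space :: "'a topology \<Rightarrow> bool" where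
  "monotone_convergence_space X \<longleftrightarrow> t0_space X \<and>
     (\<forall>D. directed_in (specialization X) D \<longrightarrow>
        (\<exists>!x. x \<in> topspace X \<and> X closure_of D = X closure_of {x}))"

definition is_D_completion :: "'a topology \<Rightarrow> 'b topology \<Rightarrow> ('a \<Rightarrow> 'b) \<Rightarrow> bool" where
  "is_D_completion X Y j \<longleftrightarrow> monotone_convergence_space Y \<and> embedding_map X Y j \<and>
     cl_d (specialization Y) (j ` topspace X) = topspace Y"

end

theory Submission
  imports Defs
begin

text \<open>
  The specialization order of \<open>K_space X\<close> is inclusion, and membership in \<open>K_sets X\<close> survives
  directed suprema: if \<open>closure(\<Union>D)\<close> lies below \<open>sup \<D>\<close> with \<open>\<D>\<close> in \<open>family_H X\<close>, then so does
  each member of \<open>D\<close>, hence \<open>D \<subseteq> \<D>\<close>, and \<open>\<D>\<close> is closed under directed suprema. Since a basic open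
  set of the lower Vietoris topology asks a closed set to meet only finitely many open sets, some
  member of a directed \<open>D\<close> meets them all as soon as \<open>\<Union>D\<close> does. Therefore the closure of \<open>D\<close> is
  the closure of its supremum (\<open>closure_of_directed_K_space\<close>), which gives monotone convergence.
  The preimage of \<open>\<diamondsuit>U\<close> under the point-closure map is \<open>U\<close>, so that map,
  which is injective on a T0 space, is an embedding (\<open>embedding_map_point_closure\<close>).

  Density (\<open>K_sets_subset_d_closed\<close>) is where the definition of \<open>K_sets\<close> is exploited. Let
  \<open>M \<subseteq> K_sets X\<close> be d-closed and contain all point closures, and let \<open>A\<close> be in \<open>K_sets X\<close>. The part
  of \<open>M\<close> below \<open>A\<close> is itself a member of \<open>family_H X\<close>, and its union is \<open>A\<close> because it contains the
  closure of each point of \<open>A\<close>. The defining property of \<open>A\<close>, applied to this family, puts \<open>A\<close>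
  into \<open>M\<close>.
\<close>

section \<open>Suprema of closed sets\<close>

lemma is_lub_closed_lattice_iff:
  assumes "\<D> \<subseteq> {A. closedin X A}"
  shows "is_lub (closed_lattice X) S \<D> \<longleftrightarrow> S = X closure_of (\<Union>\<D>)"
proof -
  have "\<Union>\<D> \<subseteq> topspace X"
    using assms closedin_subset by fastforce
  then have sub: "\<Union>\<D> \<subseteq> X closure_of (\<Union>\<D>)"
    by (rule closure_of_subset)
  have "Upper (closed_lattice X) \<D> = {B. closedin X B \<and> \<Union>\<D> \<subseteq> B}"
    using assms by (auto simp: Upper_def closed_lattice_def)
  then have eq: "is_lub (closed_lattice X) S \<D> \<longleftrightarrow> closedin X S \<and> \<Union>\<D> \<subseteq> S \<and>
      (\<forall>B. closedin X B \<and> \<Union>\<D> \<subseteq> B \<longrightarrow> S \<subseteq> B)"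
    by (simp add: least_def closed_lattice_def) blast
  show ?thesis
    unfolding eq
  proof (intro iffI conjI allI impI)
    assume S: "closedin X S \<and> \<Union>\<D> \<subseteq> S \<and> (\<forall>B. closedin X B \<and> \<Union>\<D> \<subseteq> B \<longrightarrow> S \<subseteq> B)"
    show "S = X closure_of (\<Union>\<D>)"
    proof (rule equalityI)
      show "S \<subseteq> X closure_of (\<Union>\<D>)"
        using S sub by simp
      show "X closure_of (\<Union>\<D>) \<subseteq> S"
        using S by (simp add: closure_of_minimal)
    qed
  qed (use sub in \<open>simp_all add: closure_of_minimal\<close>)
qed

lemma Sup_closed_lattice:
  assumes "\<D> \<subseteq> {A. closedin X A}"
  shows "\<Squnion>\<^bsub>closed_lattice X\<^esub>\<D> = X closure_of (\<Union>\<D>)"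
  by (simp add: sup_def is_lub_closed_lattice_iff[OF assms])

lemma d_closed_cl_d:
  assumes "B \<subseteq> carrier L"
  shows "d_closed L (cl_d L B)"
proof -
  \<comment> \<open>The carrier is one of the sets intersected, which keeps the hull inside it.\<close>
  have "d_closed L (carrier L)"
    by (auto simp: d_closed_def)
  then have carr: "cl_d L B \<subseteq> carrier L"
    unfolding cl_d_def using assms by (intro hull_minimal)
  have "s \<in> cl_d L B" if D: "D \<subseteq> cl_d L B" "directed_in L D" "is_lub L s D" for D s
    unfolding cl_d_def hull_def
  proof (rule InterI)
    fix T assume "T \<in> {T. d_closed L T \<and> B \<subseteq> T}"
    then have T: "d_closed L T" "B \<subseteq> T"
      by auto
    then have "D \<subseteq> T"
      using D(1) hull_minimal[of B T "d_closed L"] by (simp add: cl_d_def)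
    then show "s \<in> T"
      using T(1) D(2,3) unfolding d_closed_def by simp
  qed
  then show ?thesis
    using carr unfolding d_closed_def by metis
qed

lemma family_H_iff:
  "\<D> \<in> family_H X \<longleftrightarrow> d_closed (closed_lattice X) \<D> \<and>
     (\<forall>A\<in>\<D>. \<forall>a\<in>A. X closure_of {a} \<in> \<D>) \<and> closedin X (\<Union>\<D>)"
proof -
  have "cl_d (closed_lattice X) \<D> = \<D> \<longleftrightarrow> d_closed (closed_lattice X) \<D>"
    if "\<D> \<subseteq> {A. closedin X A}"
    using that d_closed_cl_d[of \<D> "closed_lattice X"] hull_same[of "d_closed (closed_lattice X)" \<D>]
    by (auto simp: cl_d_def closed_lattice_def)
  moreover have "d_closed (closed_lattice X) \<D> \<Longrightarrow> \<D> \<subseteq> {A. closedin X A}"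
    by (simp add: d_closed_def closed_lattice_def)
  ultimately show ?thesis
    unfolding family_H_def by (auto simp: closure_of_eq)
qed

text \<open>The supremum of a member of \<open>family_H\<close> is its plain union, because that union is already
  closed.\<close>

lemma K_sets_iff:
  "A \<in> K_sets X \<longleftrightarrow> closedin X A \<and> (\<forall>\<D>\<in>family_H X. A \<subseteq> \<Union>\<D> \<longrightarrow> A \<in> \<D>)"
proof -
  have "\<Squnion>\<^bsub>closed_lattice X\<^esub>\<D> = \<Union>\<D>" if "\<D> \<in> family_H X" for \<D>
    using that by (simp add: family_H_def Sup_closed_lattice)
  then show ?thesis
    by (auto simp: K_sets_def)
qed

lemma point_closure_in_K_sets:
  assumes "x \<in> topspace X"
  shows "X closure_of {x} \<in> K_sets X"
proof -
  have "x \<in> X closure_of {x}"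
    using assms by (simp add: in_closure_of)
  then show ?thesis
    by (auto simp: K_sets_iff family_H_iff)
qed

lemma directed_Sup_in_K_sets:
  assumes dir: "directed_in (closed_lattice X) D" and D: "D \<subseteq> K_sets X"
  shows "X closure_of (\<Union>D) \<in> K_sets X"
  unfolding K_sets_iff
proof (intro conjI ballI impI)
  fix \<D> assume H: "\<D> \<in> family_H X" and sub: "X closure_of (\<Union>D) \<subseteq> \<Union>\<D>"
  have lub: "is_lub (closed_lattice X) (X closure_of (\<Union>D)) D"
    using dir by (subst is_lub_closed_lattice_iff) (auto simp: directed_in_def closed_lattice_def)
  have "A \<in> \<D>" if "A \<in> D" for A
  proof -
    have "A \<subseteq> X closure_of (\<Union>D)"
      using lub that dir by (auto simp: least_def Upper_def directed_in_def closed_lattice_def)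
    then have "A \<subseteq> \<Union>\<D>"
      using sub by (rule subset_trans)
    moreover have "A \<in> K_sets X"
      using D that by (rule subsetD)
    ultimately show ?thesis
      using H by (simp add: K_sets_iff)
  qed
  then have "D \<subseteq> \<D>"
    by (rule subsetI)
  moreover have "d_closed (closed_lattice X) \<D>"
    using H by (simp add: family_H_iff)
  ultimately show "X closure_of (\<Union>D) \<in> \<D>"
    using dir lub unfolding d_closed_def by simp
qed simp

section \<open>The lower Vietoris topology\<close>

lemma topspace_lower_vietoris: "topspace (lower_vietoris X) = {A. closedin X A}"
  by (simp add: lower_vietoris_def)

lemma topspace_K_space: "topspace (K_space X) = K_sets X"
  by (auto simp: K_space_def topspace_lower_vietoris K_sets_def)

lemma openin_lower_vietoris_hit:
  assumes "openin X U"
  shows "openin (lower_vietoris X) {A. closedin X A \<and> A \<inter> U \<noteq> {}}"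
  unfolding lower_vietoris_def openin_subbase
  by (rule arbitrary_union_of_inc, rule relative_to_subset_inc[OF _ finite_intersection_of_inc])
    (use assms in auto)

lemma openin_K_space_hit:
  assumes "openin X U"
  shows "openin (K_space X) {A \<in> K_sets X. A \<inter> U \<noteq> {}}"
proof -
  have "{A \<in> K_sets X. A \<inter> U \<noteq> {}} = {A. closedin X A \<and> A \<inter> U \<noteq> {}} \<inter> K_sets X"
    by (auto simp: K_sets_def)
  then show ?thesis
    unfolding K_space_def openin_subtopology using openin_lower_vietoris_hit[OF assms] by blast
qed

lemma lower_vietoris_basic_neighbourhood:
  assumes "openin (lower_vietoris X) W" "A \<in> W"
  obtains \<U> where "finite \<U>" "\<And>U. U \<in> \<U> \<Longrightarrow> openin X U \<and> A \<inter> U \<noteq> {}"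
    "\<And>B. closedin X B \<Longrightarrow> (\<And>U. U \<in> \<U> \<Longrightarrow> B \<inter> U \<noteq> {}) \<Longrightarrow> B \<in> W"
proof -
  obtain V where V: "((finite intersection_of
      (\<lambda>S. \<exists>U. openin X U \<and> S = {A. closedin X A \<and> A \<inter> U \<noteq> {}})) relative_to {A. closedin X A}) V"
    and AV: "A \<in> V" and VW: "V \<subseteq> W"
    using assms unfolding lower_vietoris_def openin_subbase arbitrary_union_of_alt by blast
  then obtain \<S> where fin: "finite \<S>" and VS: "V = {A. closedin X A} \<inter> \<Inter>\<S>"
    and "\<forall>S\<in>\<S>. \<exists>U. openin X U \<and> S = {A. closedin X A \<and> A \<inter> U \<noteq> {}}"
    unfolding relative_to_def intersection_of_def by blast
  then obtain u where u: "\<And>S. S \<in> \<S> \<Longrightarrow> openin X (u S)"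
      "\<And>S. S \<in> \<S> \<Longrightarrow> S = {A. closedin X A \<and> A \<inter> u S \<noteq> {}}"
    by metis
  show thesis
  proof
    show "finite (u ` \<S>)"
      using fin by simp
    show "openin X U \<and> A \<inter> U \<noteq> {}" if "U \<in> u ` \<S>" for U
      using that u AV VS by blast
    show "B \<in> W" if "closedin X B" "\<And>U. U \<in> u ` \<S> \<Longrightarrow> B \<inter> U \<noteq> {}" for B
      using that u(2) VW VS by blast
  qed
qed

lemma directed_hits_finitely_many:
  assumes dir: "directed_in (closed_lattice X) D" and "finite \<U>"
    and "\<And>U. U \<in> \<U> \<Longrightarrow> \<Union>D \<inter> U \<noteq> {}"
  shows "\<exists>B\<in>D. \<forall>U\<in>\<U>. B \<inter> U \<noteq> {}"
  using assms(2,3)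
proof (induction \<U> rule: finite_induct)
  case empty
  then show ?case
    using dir by (auto simp: directed_in_def)
next
  case (insert U \<U>)
  obtain B where B: "B \<in> D" "\<forall>V\<in>\<U>. B \<inter> V \<noteq> {}"
    using insert by auto
  obtain C where C: "C \<in> D" "C \<inter> U \<noteq> {}"
    using insert.prems[of U] by auto
  have "\<forall>B\<in>D. \<forall>C\<in>D. \<exists>E\<in>D. B \<subseteq> E \<and> C \<subseteq> E"
    using dir by (simp add: directed_in_def closed_lattice_def)
  then obtain E where "E \<in> D" "B \<subseteq> E" "C \<subseteq> E"
    using B(1) C(1) by meson
  then show ?case
    using B(2) C(2) by (intro bexI[of _ E]) blast+
qed

text \<open>A closed set below the supremum of \<open>D\<close> cannot be separated from \<open>D\<close>: a basic neighbourhood of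
  it consists of finitely many hitting conditions, all of which are met by a single member of \<open>D\<close>.
  A closed set that is not below the supremum is separated by the complement of the supremum.\<close>

lemma closure_of_directed_K_space:
  assumes dir: "directed_in (closed_lattice X) D" and D: "D \<subseteq> K_sets X"
  shows "K_space X closure_of D = {A \<in> K_sets X. A \<subseteq> X closure_of (\<Union>D)}"
proof (intro equalityI subsetI CollectI conjI)
  fix A assume A: "A \<in> K_space X closure_of D"
  then show AK: "A \<in> K_sets X"
    by (simp add: in_closure_of topspace_K_space)
  have nbhd: "\<exists>B\<in>D. B \<in> W" if "A \<in> W" "openin (K_space X) W" for W
    using A that by (auto simp: in_closure_of)
  fix a assume a: "a \<in> A"
  have "a \<in> topspace X"
    using a AK closedin_subset[of X A] by (auto simp: K_sets_iff)
  moreover have "\<exists>y. y \<in> \<Union>D \<and> y \<in> U" if U: "a \<in> U" "openin X U" for U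
  proof -
    have "A \<in> {A \<in> K_sets X. A \<inter> U \<noteq> {}}"
      using AK a U(1) by auto
    from nbhd[OF this openin_K_space_hit[OF U(2)]] show ?thesis
      by auto
  qed
  ultimately show "a \<in> X closure_of (\<Union>D)"
    unfolding in_closure_of by iprover
next
  fix A assume A: "A \<in> {A \<in> K_sets X. A \<subseteq> X closure_of (\<Union>D)}"
  have "\<exists>B. B \<in> D \<and> B \<in> W" if W: "A \<in> W" "openin (K_space X) W" for W
  proof -
    obtain W' where W': "openin (lower_vietoris X) W'" "W = W' \<inter> K_sets X"
      using W(2) by (auto simp: K_space_def openin_subtopology)
    then have "A \<in> W'"
      using W(1) by simp
    then obtain \<U> where "finite \<U>" and \<U>: "\<And>U. U \<in> \<U> \<Longrightarrow> openin X U \<and> A \<inter> U \<noteq> {}"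
      and hit: "\<And>B. closedin X B \<Longrightarrow> (\<And>U. U \<in> \<U> \<Longrightarrow> B \<inter> U \<noteq> {}) \<Longrightarrow> B \<in> W'"
      using lower_vietoris_basic_neighbourhood[OF W'(1)] by metis
    have "\<Union>D \<inter> U \<noteq> {}" if "U \<in> \<U>" for U
    proof -
      have "openin X U" "U \<inter> X closure_of (\<Union>D) \<noteq> {}"
        using \<U>[OF that] A by auto
      then show ?thesis
        by (simp add: openin_Int_closure_of_eq_empty Int_commute)
    qed
    then obtain B where B: "B \<in> D" "\<forall>U\<in>\<U>. B \<inter> U \<noteq> {}"
      using directed_hits_finitely_many[OF dir \<open>finite \<U>\<close>] by metis
    moreover have BK: "B \<in> K_sets X"
      using D B(1) by (rule subsetD)
    ultimately have "B \<in> W'"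
      using hit by (simp add: K_sets_iff)
    then show ?thesis
      using B(1) BK W'(2) by auto
  qed
  moreover have "A \<in> topspace (K_space X)"
    using A by (simp add: topspace_K_space)
  ultimately show "A \<in> K_space X closure_of D"
    unfolding in_closure_of by iprover
qed

lemma closure_of_singleton_K_space:
  assumes "B \<in> K_sets X"
  shows "K_space X closure_of {B} = {A \<in> K_sets X. A \<subseteq> B}"
proof -
  have "closedin X B"
    using assms by (simp add: K_sets_iff)
  then have "directed_in (closed_lattice X) {B}" "X closure_of (\<Union>{B}) = B"
    by (auto simp: directed_in_def closed_lattice_def closure_of_closedin)
  then show ?thesis
    using closure_of_directed_K_space[of X "{B}"] assms by simp
qed

section \<open>Order and convergence in the completion\<close>

lemma le_specialization_K_space:
  assumes "A \<in> K_sets X" "B \<in> K_sets X"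
  shows "A \<sqsubseteq>\<^bsub>specialization (K_space X)\<^esub> B \<longleftrightarrow> A \<subseteq> B"
  using assms by (simp add: specialization_def closure_of_singleton_K_space)

lemma directed_in_specialization_K_space_iff:
  "directed_in (specialization (K_space X)) D \<longleftrightarrow>
     directed_in (closed_lattice X) D \<and> D \<subseteq> K_sets X"
proof (cases "D \<subseteq> K_sets X")
  case True
  then have "A \<sqsubseteq>\<^bsub>specialization (K_space X)\<^esub> B \<longleftrightarrow> A \<sqsubseteq>\<^bsub>closed_lattice X\<^esub> B"
    if "A \<in> D" "B \<in> D" for A B
    using that le_specialization_K_space[of A X B] by (auto simp: closed_lattice_def)
  moreover have "carrier (specialization (K_space X)) = K_sets X"
    "D \<subseteq> carrier (closed_lattice X)"
    using True by (auto simp: specialization_def topspace_K_space closed_lattice_def K_sets_def)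
  ultimately show ?thesis
    using True unfolding directed_in_def by (metis (no_types, lifting))
next
  case False
  then show ?thesis
    by (simp add: directed_in_def specialization_def topspace_K_space)
qed

text \<open>Directed suprema in the completion agree with those in the lattice of all closed sets, because
  the latter do not leave \<open>K_sets\<close>. Hence d-closedness in the completion can be transferred to the
  lattice, where membership in \<open>family_H\<close> is decided.\<close>

lemma is_lub_specialization_K_space:
  assumes dir: "directed_in (closed_lattice X) D" and D: "D \<subseteq> K_sets X"
  shows "is_lub (specialization (K_space X)) (X closure_of (\<Union>D)) D"
proof -
  have S: "X closure_of (\<Union>D) \<in> K_sets X"
    by (rule directed_Sup_in_K_sets[OF assms])
  have carr: "carrier (specialization (K_space X)) = K_sets X"
    by (simp add: specialization_def topspace_K_space)
  have lub: "is_lub (closed_lattice X) (X closure_of (\<Union>D)) D"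
    using dir by (subst is_lub_closed_lattice_iff) (auto simp: directed_in_def closed_lattice_def)
  have upper: "A \<subseteq> X closure_of (\<Union>D)" if "A \<in> D" for A
    using lub that dir by (auto simp: least_def Upper_def directed_in_def closed_lattice_def)
  have least: "X closure_of (\<Union>D) \<subseteq> B" if "B \<in> K_sets X" "\<And>A. A \<in> D \<Longrightarrow> A \<subseteq> B" for B
    using that by (simp add: K_sets_iff Sup_least closure_of_minimal)
  have "Upper (specialization (K_space X)) D = {B \<in> K_sets X. \<forall>A\<in>D. A \<subseteq> B}"
    using D subsetD[OF D] by (fastforce simp: Upper_def carr le_specialization_K_space)
  then show ?thesis
    using S upper least by (auto simp: least_def carr le_specialization_K_space)
qed

lemma monotone_convergence_space_K_space: "monotone_convergence_space (K_space X)"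
proof -
  have inj: "A = B"
    if AB: "A \<in> K_sets X" "B \<in> K_sets X"
      and eq: "K_space X closure_of {A} = K_space X closure_of {B}" for A B
  proof -
    have "{C \<in> K_sets X. C \<subseteq> A} = {C \<in> K_sets X. C \<subseteq> B}"
      using eq by (simp only: AB closure_of_singleton_K_space)
    then show ?thesis
      using AB by blast
  qed
  have "\<exists>!A. A \<in> K_sets X \<and> K_space X closure_of D = K_space X closure_of {A}"
    if D: "directed_in (closed_lattice X) D" "D \<subseteq> K_sets X" for D
  proof (rule ex_ex1I)
    show "\<exists>A. A \<in> K_sets X \<and> K_space X closure_of D = K_space X closure_of {A}"
      using directed_Sup_in_K_sets[OF D] closure_of_directed_K_space[OF D]
        closure_of_singleton_K_space[OF directed_Sup_in_K_sets[OF D]]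
      by (intro exI[of _ "X closure_of (\<Union>D)"]) simp
  next
    fix A B
    assume "A \<in> K_sets X \<and> K_space X closure_of D = K_space X closure_of {A}"
      and "B \<in> K_sets X \<and> K_space X closure_of D = K_space X closure_of {B}"
    then show "A = B"
      by (intro inj) simp_all
  qed
  moreover have "t0_space (K_space X)"
    unfolding t0_space_closure_of_sing topspace_K_space by (intro ballI impI inj)
  ultimately show ?thesis
    by (simp add: monotone_convergence_space_def topspace_K_space
        directed_in_specialization_K_space_iff)
qed

section \<open>The embedding and its density\<close>

lemma point_closure_hits_iff:
  assumes "openin X U"
  shows "X closure_of {x} \<inter> U \<noteq> {} \<longleftrightarrow> x \<in> U"
  using openin_Int_closure_of_eq_empty[OF assms, of "{x}"] by (simp add: inf.commute[of _ U])

lemma embedding_map_point_closure: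
  assumes "t0_space X"
  shows "embedding_map X (K_space X) (\<lambda>x. X closure_of {x})" (is "embedding_map X _ ?\<eta>")
proof -
  let ?Y = "subtopology (K_space X) (?\<eta> ` topspace X)"
  have cont: "continuous_map X (K_space X) ?\<eta>"
    unfolding K_space_def continuous_map_in_subtopology
  proof
    show "continuous_map X (lower_vietoris X) ?\<eta>"
      unfolding lower_vietoris_def
    proof (rule continuous_map_into_topology_subbase)
      fix V assume "\<exists>U. openin X U \<and> V = {A. closedin X A \<and> A \<inter> U \<noteq> {}}"
      then obtain U where U: "openin X U" "V = {A. closedin X A \<and> A \<inter> U \<noteq> {}}"
        by blast
      then have "{x \<in> topspace X. ?\<eta> x \<in> V} = U"
        using openin_subset by (auto simp: point_closure_hits_iff)
      then show "openin X {x \<in> topspace X. ?\<eta> x \<in> V}"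
        using U(1) by simp
    qed simp
  qed (auto simp: point_closure_in_K_sets)
  have inj: "inj_on ?\<eta> (topspace X)"
    using assms by (auto simp: inj_on_def t0_space_closure_of_sing)
  have "openin ?Y (?\<eta> ` U)" if U: "openin X U" for U
  proof -
    have "?\<eta> x \<in> {A \<in> K_sets X. A \<inter> U \<noteq> {}} \<longleftrightarrow> x \<in> U" if "x \<in> topspace X" for x
      using that point_closure_hits_iff[OF U, of x] by (simp add: point_closure_in_K_sets)
    then have "?\<eta> ` U = {A \<in> K_sets X. A \<inter> U \<noteq> {}} \<inter> ?\<eta> ` topspace X"
      using openin_subset[OF U] by blast
    then show ?thesis
      using openin_subtopology_Int[OF openin_K_space_hit[OF U]] by simp
  qed
  then have "embedding_map X ?Y ?\<eta>"
    using cont inj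
    by (intro injective_open_imp_embedding_map) (auto simp: continuous_map_in_subtopology open_map_def)
  then show ?thesis
    by (simp add: embedding_map_in_subtopology)
qed

lemma K_sets_subset_d_closed:
  assumes M: "d_closed (specialization (K_space X)) M"
    and points: "\<And>x. x \<in> topspace X \<Longrightarrow> X closure_of {x} \<in> M"
  shows "K_sets X \<subseteq> M"
proof
  fix A assume A: "A \<in> K_sets X"
  then have clA: "closedin X A"
    by (simp add: K_sets_iff)
  have MK: "M \<subseteq> K_sets X"
    using M by (simp add: d_closed_def specialization_def topspace_K_space)
  \<comment> \<open>The test family: both \<open>M\<close> and the sets below \<open>A\<close> are stable under directed suprema.\<close>
  define \<D> where "\<D> = {B \<in> M. B \<subseteq> A}"
  have below: "X closure_of {a} \<in> \<D>" and self: "a \<in> X closure_of {a}" if "a \<in> A" for a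
    using that clA closedin_subset[OF clA]
    by (auto simp: \<D>_def points closure_of_minimal in_closure_of)
  have Union: "\<Union>\<D> = A"
    using below self by (auto simp: \<D>_def)
  have \<D>_closed: "\<D> \<subseteq> {B. closedin X B}"
    using MK by (auto simp: \<D>_def K_sets_iff)
  have "d_closed (closed_lattice X) \<D>"
    unfolding d_closed_def
  proof (intro conjI allI impI)
    show "\<D> \<subseteq> carrier (closed_lattice X)"
      using \<D>_closed by (simp add: closed_lattice_def)
  next
    fix D S
    assume asm: "D \<subseteq> \<D> \<and> directed_in (closed_lattice X) D \<and> is_lub (closed_lattice X) S D"
    then have D: "D \<subseteq> M" "D \<subseteq> K_sets X" "directed_in (closed_lattice X) D"
      and S: "S = X closure_of (\<Union>D)"
      using \<D>_closed MK is_lub_closed_lattice_iff[of D X S] by (auto simp: \<D>_def)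
    have "S \<in> M"
      using M D is_lub_specialization_K_space[OF D(3,2)]
      unfolding d_closed_def S directed_in_specialization_K_space_iff by blast
    moreover have "S \<subseteq> A"
      unfolding S by (rule closure_of_minimal[OF _ clA]) (use asm in \<open>auto simp: \<D>_def\<close>)
    ultimately show "S \<in> \<D>"
      by (simp add: \<D>_def)
  qed
  moreover have "X closure_of {a} \<in> \<D>" if "B \<in> \<D>" "a \<in> B" for B a
    using that below by (auto simp: \<D>_def)
  ultimately have "\<D> \<in> family_H X"
    using clA by (simp add: family_H_iff Union)
  then have "A \<in> \<D>"
    using A Union by (auto simp: K_sets_iff)
  then show "A \<in> M"
    by (simp add: \<D>_def)
qed

theorem theorem5p15:
  fixes X :: "'a topology"
  assumes "t0_space X"
  shows "is_D_completion X (K_space X) (\<lambda>x. X closure_of {x})"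
proof -
  let ?L = "specialization (K_space X)" and ?P = "(\<lambda>x. X closure_of {x}) ` topspace X"
  have carr: "carrier ?L = K_sets X"
    by (simp add: specialization_def topspace_K_space)
  have "?P \<subseteq> carrier ?L"
    by (auto simp: carr point_closure_in_K_sets)
  then have M: "d_closed ?L (cl_d ?L ?P)"
    by (rule d_closed_cl_d)
  have "?P \<subseteq> cl_d ?L ?P"
    by (simp add: cl_d_def hull_subset)
  then have "K_sets X \<subseteq> cl_d ?L ?P"
    by (intro K_sets_subset_d_closed[OF M]) blast
  moreover have "cl_d ?L ?P \<subseteq> K_sets X"
    using M by (simp add: d_closed_def carr)
  ultimately have "cl_d ?L ?P = topspace (K_space X)"
    by (simp add: topspace_K_space)
  then show ?thesis
    by (simp add: is_D_completion_def monotone_convergence_space_K_space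
        embedding_map_point_closure[OF assms])
qed

end
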